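(* For all integers $r,s\ge 0$ and $t\ge 1$, \[ P(r+1,s+1,t)\,P(r,s,t) = q^t\,P(r,s+1,t)\,P(r+1,s,t) + P(r+1,s+1,t-1)\,P(r,s,t+1). \]
   Context: A plane partition fitting in the box $\mathcal{B}(r,s,t)$ is an $r\times s$ array $(\pi_{ij})_{1\le i\le r,\,1\le j\le s}$ of integers with $0\le \pi_{ij}\le t$, weakly decreasing along each row and each column. $P(r,s,t)=\sum_\pi q^{|\pi|}$, the sum over all plane partitions fitting in $\mathcal{B}(r,s,t)$, where $|\pi|=\sum_{i,j}\pi_{ij}$; this is a polynomial in $q$, and $P(r,s,t)=1$ if $r=0$, $s=0$ or $t=0$. *)

theory Defs
  imports "HOL-Computational_Algebra.Polynomial"
begin

text \<open>
  An \<open>r \<times> s\<close> array with rows \<open>1..r\<close> and columns \<open>1..s\<close> is a function on pairs of naturals that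
  is required to vanish off the index rectangle, so that each array has exactly one representative.
\<close>

definition plane_partition_in_box :: "nat \<Rightarrow> nat \<Rightarrow> nat \<Rightarrow> (nat \<Rightarrow> nat \<Rightarrow> nat) \<Rightarrow> bool" where
  "plane_partition_in_box r s t \<pi> \<longleftrightarrow>
     (\<forall>i\<in>{1..r}. \<forall>j\<in>{1..s}. \<pi> i j \<le> t) \<and>
     (\<forall>i\<in>{1..r}. \<forall>j\<in>{1..s}. \<forall>j'\<in>{1..s}. j \<le> j' \<longrightarrow> \<pi> i j' \<le> \<pi> i j) \<and>
     (\<forall>i\<in>{1..r}. \<forall>i'\<in>{1..r}. \<forall>j\<in>{1..s}. i \<le> i' \<longrightarrow> \<pi> i' j \<le> \<pi> i j) \<and>
     (\<forall>i j. \<not> (i \<in> {1..r} \<and> j \<in> {1..s}) \<longrightarrow> \<pi> i j = 0)"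

definition pp_size :: "nat \<Rightarrow> nat \<Rightarrow> (nat \<Rightarrow> nat \<Rightarrow> nat) \<Rightarrow> nat" where
  "pp_size r s \<pi> = (\<Sum>i=1..r. \<Sum>j=1..s. \<pi> i j)"

text \<open>\<open>monom 1 n\<close> is \<open>q ^ n\<close>, where \<open>q\<close> is the indeterminate of \<^typ>\<open>int poly\<close>.\<close>

definition PP :: "nat \<Rightarrow> nat \<Rightarrow> nat \<Rightarrow> int poly" where
  "PP r s t = (\<Sum>\<pi> | plane_partition_in_box r s t \<pi>. monom 1 (pp_size r s \<pi>))"

text \<open>The sum in \<open>PP\<close> is over a finite set, so it does not degenerate to \<open>0\<close>.\<close>

lemma finite_plane_partitions_in_box: "finite {\<pi>. plane_partition_in_box r s t \<pi>}"
proof -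
  let ?F = "{f. \<forall>x. (x \<in> {1..r} \<times> {1..s} \<longrightarrow> f x \<in> {..t}) \<and> (x \<notin> {1..r} \<times> {1..s} \<longrightarrow> f x = (0::nat))}"
  have "finite ?F"
    by (rule finite_set_of_finite_funs) auto
  moreover have "case_prod ` {\<pi>. plane_partition_in_box r s t \<pi>} \<subseteq> ?F"
    by (auto simp: plane_partition_in_box_def)
  ultimately have "finite (case_prod ` {\<pi>. plane_partition_in_box r s t \<pi>})"
    by (rule rev_finite_subset)
  moreover have "inj_on case_prod {\<pi>. plane_partition_in_box r s t \<pi>}"
    by (rule inj_on_inverseI[where g = curry]) (rule curry_case_prod)
  ultimately show ?thesis
    by (rule finite_imageD)
qed

lemma PP_degenerate:
  assumes "r = 0 \<or> s = 0 \<or> t = 0"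
  shows "PP r s t = 1"
proof -
  have "\<pi> = (\<lambda>_ _. 0)" if "plane_partition_in_box r s t \<pi>" for \<pi>
  proof (intro ext)
    fix i j
    show "\<pi> i j = 0"
    proof (cases "i \<in> {1..r} \<and> j \<in> {1..s}")
      case True
      with that have "\<pi> i j \<le> t"
        unfolding plane_partition_in_box_def by blast
      with True assms show ?thesis by auto
    next
      case False
      with that show ?thesis
        unfolding plane_partition_in_box_def by blast
    qed
  qed
  moreover have "plane_partition_in_box r s t (\<lambda>_ _. 0)"
    by (simp add: plane_partition_in_box_def)
  ultimately have "{\<pi>. plane_partition_in_box r s t \<pi>} = {\<lambda>_ _. 0}"
    by blast
  then show ?thesis
    by (simp add: PP_def pp_size_def)
qed

end

theory Submission
  imports Defs "Jordan_Normal_Form.Determinant"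
begin

text \<open>
  Read the diagonals of a plane partition in the box as interlacing sequences and complete them by
  entries \<open>t\<close> and \<open>0\<close> to a Gelfand--Tsetlin triangle of size \<open>r + s\<close> with main diagonal
  \<open>(t\<^sup>r, 0\<^sup>s)\<close>. Weighted by the sum of the entries, the triangles with main diagonal \<open>\<mu>\<close> are counted,
  up to a factor independent of \<open>\<mu>\<close>, by \<open>\<Prod>i. x\<^sub>i\<close> times the Vandermonde product of
  \<open>x\<^sub>i = q ^ (\<mu> i + n - 1 - i)\<close>: peeling off the main diagonal sums each row of a Vandermonde
  determinant over an interval, and these geometric sums turn the powers into differences
  \<open>x\<^sub>i\<^sup>j - x\<^sub>i\<^sub>+\<^sub>1\<^sup>j\<close>, that is, into a Vandermonde determinant of the next size. Comparing with
  \<open>t = 0\<close> removes the factor and gives MacMahon's product formula, which reduces the theorem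
  to \<open>1 - q\<^sup>t\<^sup>+\<^sup>m = q\<^sup>t (1 - q\<^sup>m) + (1 - q\<^sup>t)\<close> for \<open>m = r + s + 1\<close>.
\<close>

section \<open>Multilinear expansion of determinants and the Vandermonde determinant\<close>

text \<open>Distributivity, by induction on \<open>n\<close>: a choice function on
  \<open>{..<Suc n}\<close> is one on \<open>{..<n}\<close> updated at \<open>n\<close>.\<close>

lemma prod_sum_PiE_lessThan:
  fixes f :: "nat \<Rightarrow> 'b \<Rightarrow> 'a::comm_semiring_1"
  shows "(\<Prod>i<n. \<Sum>y\<in>B i. f i y) = (\<Sum>\<mu>\<in>Pi\<^sub>E {..<n} B. \<Prod>i<n. f i (\<mu> i))"
proof (induction n)
  case (Suc n)
  have inj: "inj_on (\<lambda>(y, \<mu>). \<mu>(n := y)) (B n \<times> Pi\<^sub>E {..<n} B)"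
    using inj_combinator[of n "{..<n}" B] by simp
  have "(\<Sum>\<mu>\<in>Pi\<^sub>E {..<Suc n} B. \<Prod>i<Suc n. f i (\<mu> i)) =
      (\<Sum>(y, \<mu>)\<in>B n \<times> Pi\<^sub>E {..<n} B. \<Prod>i<Suc n. f i ((\<mu>(n := y)) i))"
    unfolding lessThan_Suc PiE_insert_eq sum.reindex[OF inj] by (simp only: o_def case_prod_unfold)
  also have "\<dots> = (\<Sum>(y, \<mu>)\<in>B n \<times> Pi\<^sub>E {..<n} B. f n y * (\<Prod>i<n. f i (\<mu> i)))"
  proof -
    have "(\<Prod>i<Suc n. f i ((\<mu>(n := y)) i)) = f n y * (\<Prod>i<n. f i (\<mu> i))" for y \<mu>
      by (simp add: mult.commute)
    then show ?thesis by simp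
  qed
  also have "\<dots> = (\<Sum>y\<in>B n. f n y) * (\<Sum>\<mu>\<in>Pi\<^sub>E {..<n} B. \<Prod>i<n. f i (\<mu> i))"
    by (simp only: sum_product sum.cartesian_product)
  finally show ?case
    by (simp only: Suc.IH prod.lessThan_Suc mult.commute)
qed simp

lemma det_row_scale:
  fixes f :: "nat \<Rightarrow> nat \<Rightarrow> 'a::comm_ring_1"
  shows "det (mat n n (\<lambda>(i, j). c i * f i j)) = (\<Prod>i<n. c i) * det (mat n n (\<lambda>(i, j). f i j))"
  by (simp add: det_def'[of _ n] sum_distrib_left permutes_in_image prod.distrib
      atLeast0LessThan mult.left_commute)

lemma det_col_scale:
  fixes f :: "nat \<Rightarrow> nat \<Rightarrow> 'a::comm_ring_1"
  shows "det (mat n n (\<lambda>(i, j). c j * f i j)) = (\<Prod>j<n. c j) * det (mat n n (\<lambda>(i, j). f i j))"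
proof -
  have "(\<Prod>i\<in>{0..<n}. c (p i)) = (\<Prod>j\<in>{0..<n}. c j)" if "p permutes {0..<n}" for p
    using prod.permute[OF that, of c] by (simp add: o_def)
  then show ?thesis
    by (simp add: det_def'[of _ n] sum_distrib_left permutes_in_image prod.distrib
        mult.left_commute flip: atLeast0LessThan)
qed

text \<open>Multilinearity in the rows. Each row has its own index set, so the choices form a box,
  as do the diagonals interlacing with a given one.\<close>

lemma det_row_sum_PiE:
  fixes f :: "nat \<Rightarrow> 'b \<Rightarrow> nat \<Rightarrow> 'a::comm_ring_1"
  shows "det (mat n n (\<lambda>(i, j). \<Sum>y\<in>B i. f i y j)) =
    (\<Sum>\<mu>\<in>Pi\<^sub>E {..<n} B. det (mat n n (\<lambda>(i, j). f i (\<mu> i) j)))"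
proof -
  have "det (mat n n (\<lambda>(i, j). \<Sum>y\<in>B i. f i y j)) =
      (\<Sum>p | p permutes {0..<n}. signof p * (\<Prod>i<n. \<Sum>y\<in>B i. f i y (p i)))"
    by (simp add: det_def'[of _ n] permutes_in_image atLeast0LessThan)
  also have "\<dots> = (\<Sum>\<mu>\<in>Pi\<^sub>E {..<n} B. \<Sum>p | p permutes {0..<n}.
      signof p * (\<Prod>i<n. f i (\<mu> i) (p i)))"
    unfolding prod_sum_PiE_lessThan sum_distrib_left by (rule sum.swap)
  also have "\<dots> = (\<Sum>\<mu>\<in>Pi\<^sub>E {..<n} B. det (mat n n (\<lambda>(i, j). f i (\<mu> i) j)))"
    by (simp add: det_def'[of _ n] permutes_in_image atLeast0LessThan)
  finally show ?thesis .
qed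

text \<open>Laplace expansion along row \<open>n\<close> keeps only the corner
  \<open>(n, 0)\<close>, whose cofactor has sign \<open>(- 1) ^ n\<close>.\<close>

lemma det_unit_last_row:
  fixes f :: "nat \<Rightarrow> nat \<Rightarrow> 'a::comm_ring_1"
  assumes "f n 0 = 1" "\<And>j. j < n \<Longrightarrow> f n (Suc j) = 0"
  shows "det (mat (Suc n) (Suc n) (\<lambda>(i, j). f i j)) = (- 1) ^ n * det (mat n n (\<lambda>(i, j). f i (Suc j)))"
proof -
  let ?A = "mat (Suc n) (Suc n) (\<lambda>(i, j). f i j)"
  have del: "mat_delete ?A n 0 = mat n n (\<lambda>(i, j). f i (Suc j))"
    by (rule eq_matI) (auto simp: mat_delete_def)
  have "det ?A = (\<Sum>j<Suc n. ?A $$ (n, j) * cofactor ?A n j)"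
    by (rule laplace_expansion_row) auto
  also have "\<dots> = cofactor ?A n 0"
    using assms by (subst sum.lessThan_Suc_shift) simp
  finally show ?thesis
    by (simp add: cofactor_def del)
qed

lemma det_unit_first_col:
  fixes f :: "nat \<Rightarrow> nat \<Rightarrow> 'a::comm_ring_1"
  assumes "f n 0 = 1" "\<And>i. i < n \<Longrightarrow> f i 0 = 0"
  shows "det (mat (Suc n) (Suc n) (\<lambda>(i, j). f i j)) = (- 1) ^ n * det (mat n n (\<lambda>(i, j). f i (Suc j)))"
proof -
  let ?A = "mat (Suc n) (Suc n) (\<lambda>(i, j). f i j)"
  have del: "mat_delete ?A n 0 = mat n n (\<lambda>(i, j). f i (Suc j))"
    by (rule eq_matI) (auto simp: mat_delete_def)
  have "det ?A = (\<Sum>i<Suc n. ?A $$ (i, 0) * cofactor ?A i 0)"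
    by (rule laplace_expansion_column) auto
  also have "\<dots> = cofactor ?A n 0"
    using assms by simp
  finally show ?thesis
    by (simp add: cofactor_def del)
qed

text \<open>Subtracting from each row but the last its successor turns column 0 into a single 1 at
  the bottom; expanding along that column leaves the differences.\<close>

lemma det_vandermonde_differences:
  fixes x :: "nat \<Rightarrow> 'a::comm_ring_1"
  shows "det (mat (Suc n) (Suc n) (\<lambda>(i, j). x i ^ j)) =
    (- 1) ^ n * det (mat n n (\<lambda>(i, j). x i ^ Suc j - x (Suc i) ^ Suc j))"
proof -
  let ?V = "mat (Suc n) (Suc n) (\<lambda>(i, j). x i ^ j)"
  \<comment> \<open>Left multiplication by this matrix performs the subtraction; in row
    \<open>n\<close> the index \<open>Suc i\<close> falls outside the matrix, so that row
    stays.\<close>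
  let ?U = "mat (Suc n) (Suc n) (\<lambda>(i, k). if k = i then 1 else if k = Suc i then - 1 else (0::'a))"
  let ?f = "\<lambda>i j. if i < n then x i ^ j - x (Suc i) ^ j else x i ^ j"
  let ?D = "mat (Suc n) (Suc n) (\<lambda>(i, j). ?f i j)"
  have "upper_triangular ?U"
    by auto
  then have "det ?U = 1"
    by (subst det_upper_triangular[of _ "Suc n"])
      (auto simp: prod_list_diag_prod intro!: prod.neutral)
  moreover have "?U * ?V = ?D"
  proof (rule eq_matI)
    fix i j assume ij: "i < dim_row ?D" "j < dim_col ?D"
    have "(?U * ?V) $$ (i, j) =
        (\<Sum>k\<in>{0..<Suc n}. (if k = i then x k ^ j else 0) - (if k = Suc i then x k ^ j else 0))"
      using ij by (simp del: sum.op_ivl_Suc add: scalar_prod_def) (rule sum.cong; simp)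
    also have "\<dots> = ?f i j"
      using ij unfolding sum_subtractf by (cases "i < n") (auto simp: less_Suc_eq)
    finally show "(?U * ?V) $$ (i, j) = ?D $$ (i, j)"
      using ij by simp
  qed auto
  ultimately have "det ?V = det ?D"
    using det_mult[of ?U "Suc n" ?V] by simp
  also have "\<dots> = (- 1) ^ n * det (mat n n (\<lambda>(i, j). ?f i (Suc j)))"
    by (rule det_unit_first_col) auto
  also have "mat n n (\<lambda>(i, j). ?f i (Suc j)) = mat n n (\<lambda>(i, j). x i ^ Suc j - x (Suc i) ^ Suc j)"
    by (rule eq_matI) auto
  finally show ?thesis .
qed

text \<open>Subtracting \<open>x n\<close> times the preceding column from each column clears the
  last row beyond its first entry and leaves a factor \<open>x i - x n\<close> in row
  \<open>i\<close>; the remaining minor is the smaller Vandermonde matrix.\<close>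

lemma det_vandermonde:
  fixes x :: "nat \<Rightarrow> 'a::comm_ring_1"
  shows "det (mat n n (\<lambda>(i, j). x i ^ j)) = (\<Prod>j<n. \<Prod>i<j. x j - x i)"
proof (induction n)
  case (Suc n)
  let ?V = "mat (Suc n) (Suc n) (\<lambda>(i, j). x i ^ j)"
  let ?U = "mat (Suc n) (Suc n) (\<lambda>(k, j). if k = j then 1 else if Suc k = j then - x n else 0)"
  let ?f = "\<lambda>i j. if j = 0 then 1 else (x i - x n) * x i ^ (j - 1)"
  let ?D = "mat (Suc n) (Suc n) (\<lambda>(i, j). ?f i j)"
  have "upper_triangular ?U"
    by auto
  then have "det ?U = 1"
    by (subst det_upper_triangular[of _ "Suc n"])
      (auto simp: prod_list_diag_prod intro!: prod.neutral)
  moreover have "?V * ?U = ?D"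
  proof (rule eq_matI)
    fix i j assume ij: "i < dim_row ?D" "j < dim_col ?D"
    have "(?V * ?U) $$ (i, j) =
        (\<Sum>k\<in>{0..<Suc n}. (if k = j then x i ^ j else 0) - (if Suc k = j then x n * x i ^ k else 0))"
      using ij by (simp del: sum.op_ivl_Suc add: scalar_prod_def) (rule sum.cong; simp)
    \<comment> \<open>Solving \<open>Suc k = j\<close> for \<open>k\<close> isolates one summand;
      truncated subtraction would admit \<open>k = 0\<close> for \<open>j = 0\<close>, so that case
      is set to 0.\<close>
    also have "\<dots> = (\<Sum>k\<in>{0..<Suc n}. (if k = j then x i ^ j else 0) -
         (if k = j - 1 then if j = 0 then 0 else x n * x i ^ k else 0))"
      by (rule sum.cong) auto
    also have "\<dots> = ?f i j"
      using ij by (cases j) (auto simp: sum_subtractf algebra_simps)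
    finally show "(?V * ?U) $$ (i, j) = ?D $$ (i, j)"
      using ij by simp
  qed auto
  ultimately have "det ?V = det ?D"
    using det_mult[of ?V "Suc n" ?U] by simp
  also have "\<dots> = (- 1) ^ n * det (mat n n (\<lambda>(i, j). (x i - x n) * x i ^ j))"
    by (subst det_unit_last_row) auto
  also have "\<dots> = (\<Prod>i<n. x n - x i) * (\<Prod>j<n. \<Prod>i<j. x j - x i)"
  proof -
    have "(- 1) ^ n * (\<Prod>i<n. x i - x n) = (\<Prod>i<n. x n - x i)"
      using prod.distrib[of "\<lambda>_. - 1" "\<lambda>i. x i - x n" "{..<n}"] by simp
    then show ?thesis
      by (simp only: det_row_scale Suc.IH flip: mult.assoc)
  qed
  finally show ?case
    by (simp add: mult.commute)
qed simp

section \<open>Gelfand-Tsetlin patterns and their branching rule\<close>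

text \<open>
  The triangle is stored as an array on \<open>i \<le> j < n\<close>. Its main diagonal is the top row of the usual
  Gelfand--Tsetlin pattern, and the \<open>k\<close>-th superdiagonal is the \<open>k\<close>-th row below it.
\<close>

definition gt_patterns :: "nat \<Rightarrow> (nat \<Rightarrow> nat) \<Rightarrow> (nat \<Rightarrow> nat \<Rightarrow> nat) set" where
  "gt_patterns n \<mu> = {a. (\<forall>i<n. a i i = \<mu> i) \<and>
     (\<forall>i j. i < j \<and> j < n \<longrightarrow> a (Suc i) j \<le> a i j \<and> a i j \<le> a i (j - 1)) \<and>
     (\<forall>i j. \<not> (i \<le> j \<and> j < n) \<longrightarrow> a i j = 0)}"

definition gt_size :: "nat \<Rightarrow> (nat \<Rightarrow> nat \<Rightarrow> nat) \<Rightarrow> nat" where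
  "gt_size n a = (\<Sum>j<n. \<Sum>i\<le>j. a i j)"

text \<open>For weakly decreasing \<open>\<mu>\<close> this is the Schur polynomial of
  \<open>\<mu>\<close> at \<open>q, q ^ 2, ..., q ^ n\<close>.\<close>

definition gt_gf :: "'a::comm_semiring_1 \<Rightarrow> nat \<Rightarrow> (nat \<Rightarrow> nat) \<Rightarrow> 'a" where
  "gt_gf q n \<mu> = (\<Sum>a\<in>gt_patterns n \<mu>. q ^ gt_size n a)"

lemma gt_size_Suc: "gt_size (Suc n) a = (\<Sum>i\<le>n. a i i) + gt_size n (\<lambda>i j. a i (Suc j))"
proof -
  have "gt_size (Suc n) a = (\<Sum>j\<le>n. a j j + (\<Sum>i<j. a i j))"
    by (simp add: gt_size_def lessThan_Suc_atMost ivl_disj_un_singleton(2)[symmetric] del: sum.lessThan_Suc)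
  also have "\<dots> = (\<Sum>i\<le>n. a i i) + (\<Sum>j<Suc n. \<Sum>i<j. a i j)"
    by (simp add: sum.distrib lessThan_Suc_atMost)
  \<comment> \<open>Column 0 has no entry above the diagonal, so shifting the columns by one drops
    an empty sum.\<close>
  also have "(\<Sum>j<Suc n. \<Sum>i<j. a i j) = gt_size n (\<lambda>i j. a i (Suc j))"
    by (subst sum.lessThan_Suc_shift) (simp add: gt_size_def lessThan_Suc_atMost)
  finally show ?thesis .
qed

lemma gt_size_cong: "(\<And>i j. i \<le> j \<Longrightarrow> j < n \<Longrightarrow> a i j = b i j) \<Longrightarrow> gt_size n a = gt_size n b"
  by (simp add: gt_size_def)

lemma gt_patternsD:
  assumes "a \<in> gt_patterns n \<mu>"
  shows "i < n \<Longrightarrow> a i i = \<mu> i" "i < j \<Longrightarrow> j < n \<Longrightarrow> a (Suc i) j \<le> a i j"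
    "i \<le> j \<Longrightarrow> Suc j < n \<Longrightarrow> a i (Suc j) \<le> a i j" "j < i \<or> n \<le> j \<Longrightarrow> a i j = 0"
proof -
  note * = assms[unfolded gt_patterns_def, simplified]
  show "i < n \<Longrightarrow> a i i = \<mu> i" "i < j \<Longrightarrow> j < n \<Longrightarrow> a (Suc i) j \<le> a i j"
    "j < i \<or> n \<le> j \<Longrightarrow> a i j = 0"
    using * by auto
  show "i \<le> j \<Longrightarrow> Suc j < n \<Longrightarrow> a i (Suc j) \<le> a i j"
    using *[THEN conjunct2, THEN conjunct1, THEN spec, of i, THEN spec, of "Suc j"] by simp
qed

lemma gt_patterns_row_antimono:
  assumes "a \<in> gt_patterns n \<mu>" "i \<le> j" "j \<le> k" "k < n"
  shows "a i k \<le> a i j"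
  using assms(3,4,2)
proof (induction k rule: dec_induct)
  case (step k)
  then show ?case
    using gt_patternsD(3)[OF assms(1), of i k] by simp
qed simp

lemma gt_patterns_col_antimono:
  assumes "a \<in> gt_patterns n \<mu>" "h \<le> i" "i \<le> j" "j < n"
  shows "a i j \<le> a h j"
  using assms(2,3,4)
proof (induction i rule: dec_induct)
  case (step i)
  then show ?case
    using gt_patternsD(2)[OF assms(1), of i j] by simp
qed simp

lemma gt_patterns_0: "gt_patterns 0 \<mu> = {\<lambda>_ _. 0}"
  by (auto simp: gt_patterns_def)

text \<open>Rows decrease from their diagonal entry, so the sum of the \<open>\<mu> i\<close> bounds
  every entry.\<close>

lemma finite_gt_patterns: "finite (gt_patterns n \<mu>)"
proof -
  let ?R = "{f. \<forall>j. (j \<in> {..<n} \<longrightarrow> f j \<in> {..\<Sum>i<n. \<mu> i}) \<and> (j \<notin> {..<n} \<longrightarrow> f j = (0::nat))}"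
  let ?F = "{a. \<forall>i. (i \<in> {..<n} \<longrightarrow> a i \<in> ?R) \<and> (i \<notin> {..<n} \<longrightarrow> a i = (\<lambda>_. 0))}"
  have "finite ?F"
    by (intro finite_set_of_finite_funs) simp_all
  moreover have "gt_patterns n \<mu> \<subseteq> ?F"
  proof
    fix a assume a: "a \<in> gt_patterns n \<mu>"
    have "a i j \<le> (\<Sum>i<n. \<mu> i)" if "i < n" "j < n" for i j
    proof (cases "i \<le> j")
      case True
      then have "a i j \<le> \<mu> i"
        using gt_patterns_row_antimono[OF a, of i i j] gt_patternsD(1)[OF a] that by simp
      also have "\<mu> i \<le> (\<Sum>i<n. \<mu> i)"
        using that by (intro member_le_sum) simp_all
      finally show ?thesis .
    qed (simp add: gt_patternsD(4)[OF a])
    then show "a \<in> ?F"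
      using gt_patternsD(4)[OF a] by (auto simp: fun_eq_iff not_less)
         (metis le_less_linear le_trans)
  qed
  ultimately show ?thesis by (rule rev_finite_subset)
qed

text \<open>Branching: stripping the main diagonal leaves a pattern of size \<open>n\<close>, whose
  diagonal \<open>\<nu>\<close> can be any sequence interlacing with \<open>\<mu>\<close>.\<close>

lemma gt_gf_Suc:
  "gt_gf q (Suc n) \<mu> =
    q ^ (\<Sum>i\<le>n. \<mu> i) * (\<Sum>\<nu>\<in>Pi\<^sub>E {..<n} (\<lambda>i. {\<mu> (Suc i)..\<mu> i}). gt_gf q n \<nu>)"
proof -
  let ?B = "Pi\<^sub>E {..<n} (\<lambda>i. {\<mu> (Suc i)..\<mu> i})"
  let ?top = "\<lambda>a. \<lambda>i\<in>{..<n}. a i (Suc i)"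
  let ?rest = "\<lambda>a i j. if i \<le> j then a i (Suc j) else 0"
  let ?join = "\<lambda>b i j. if i = j \<and> i < Suc n then \<mu> i else if i < j then b i (j - 1) else 0"
  have "gt_gf q (Suc n) \<mu> =
      (\<Sum>(\<nu>, b)\<in>(SIGMA \<nu>:?B. gt_patterns n \<nu>). q ^ (\<Sum>i\<le>n. \<mu> i) * q ^ gt_size n b)"
    unfolding gt_gf_def
  proof (rule sum.reindex_bij_witness[where
        i = "\<lambda>(\<nu>, b). ?join b" and j = "\<lambda>a. (?top a, ?rest a)"], goal_cases)
    case (1 a)
    show ?case
      using gt_patternsD[OF 1] by (auto simp: fun_eq_iff gt_patternsD(1)[OF 1])
  next
    case (2 a)
    note a = gt_patternsD[OF 2]
    have "?top a \<in> ?B"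
    proof (rule PiE_I)
      fix i assume "i \<in> {..<n}"
      then show "?top a i \<in> {\<mu> (Suc i)..\<mu> i}"
        using a(2)[of i "Suc i"] a(3)[of i i] a(1)[of i] a(1)[of "Suc i"] by simp
    qed simp
    moreover have "?rest a \<in> gt_patterns n (?top a)"
      unfolding gt_patterns_def
    proof (intro CollectI conjI allI impI)
      fix i j assume "i < j \<and> j < n"
      then show "?rest a (Suc i) j \<le> ?rest a i j" "?rest a i j \<le> ?rest a i (j - 1)"
        using a(2)[of i "Suc j"] a(3)[of i j] by auto
    qed (use a(4) in auto)
    ultimately show ?case by simp
  next
    case (3 p)
    then obtain \<nu> b where p: "p = (\<nu>, b)" "\<nu> \<in> ?B" "b \<in> gt_patterns n \<nu>"
      by auto
    note b = gt_patternsD[OF p(3)]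
    have "?top (?join b) = \<nu>"
      using p(2) b(1) by (auto simp: fun_eq_iff PiE_def extensional_def)
    moreover have "?rest (?join b) = b"
      using b(4) by (auto simp: fun_eq_iff)
    ultimately show ?case unfolding p(1) by (simp only: prod.case)
  next
    case (4 p)
    then obtain \<nu> b where p: "p = (\<nu>, b)" "\<nu> \<in> ?B" "b \<in> gt_patterns n \<nu>"
      by auto
    note b = gt_patternsD[OF p(3)]
    have \<nu>: "\<mu> (Suc i) \<le> b i i \<and> b i i \<le> \<mu> i" if "i < n" for i
      using PiE_mem[OF p(2), of i] b(1) that by simp
    have "?join b \<in> gt_patterns (Suc n) \<mu>"
      unfolding gt_patterns_def
    proof (intro CollectI conjI allI impI)
      fix i j assume ij: "i < j \<and> j < Suc n"
      then obtain k where k: "j = Suc k" "i \<le> k" "k < n"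
        by (cases j) auto
      \<comment> \<open>For \<open>i = k\<close> the entry lies on the first superdiagonal and its
        neighbours are diagonal entries, so the bounds are the interlacing conditions.\<close>
      show "?join b (Suc i) j \<le> ?join b i j"
        using k \<nu>[of k] b(2)[of i k] by (cases "i = k") auto
      show "?join b i j \<le> ?join b i (j - 1)"
        using k \<nu>[of k] b(3)[of i "k - 1"] by (cases "i = k") auto
    next
      fix i j assume "\<not> (i \<le> j \<and> j < Suc n)"
      then show "?join b i j = 0"
        using b(4)[of "j - 1" i] by (cases j) auto
    qed simp
    then show ?case unfolding p(1) by (simp only: prod.case)
  next
    case (5 a)
    have "gt_size n (?rest a) = gt_size n (\<lambda>i j. a i (Suc j))"
      by (rule gt_size_cong) simp
    then show ?case
      using gt_patternsD(1)[OF 5] by (simp add: gt_size_Suc power_add)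
  qed
  then show ?thesis
    by (simp add: sum.Sigma[symmetric] finite_PiE finite_gt_patterns sum_distrib_left gt_gf_def)
qed

section \<open>Vandermonde evaluation of the pattern generating function\<close>

lemma power_sum_diff_Icc:
  fixes y :: "'a::comm_ring_1"
  assumes "a \<le> b"
  shows "(y - 1) * (\<Sum>m=a..b. y ^ (m + k)) = y ^ (Suc b + k) - y ^ (a + k)"
  using assms by (induction b rule: dec_induct) (simp_all add: algebra_simps)

text \<open>Induction along the branching rule. Only a nonzero \<open>K\<close> common to all
  \<open>\<mu>\<close> is recorded, since its value drops out on comparison with
  \<open>t = 0\<close>; the hypotheses on \<open>q\<close> make its factors nonzero.\<close>

lemma gt_gf_vandermonde:
  fixes q :: "'a::idom"
  assumes "q \<noteq> 0" "\<And>k. k > 0 \<Longrightarrow> q ^ k \<noteq> 1"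
  shows "\<exists>K. K \<noteq> 0 \<and> (\<forall>\<mu>. (\<forall>i. Suc i < n \<longrightarrow> \<mu> (Suc i) \<le> \<mu> i) \<longrightarrow>
      gt_gf q n \<mu> * K = (\<Prod>i<n. q ^ (\<mu> i + (n - 1 - i))) *
        (\<Prod>j<n. \<Prod>i<j. q ^ (\<mu> j + (n - 1 - j)) - q ^ (\<mu> i + (n - 1 - i))))"
proof (induction n)
  case 0
  show ?case by (rule exI[of _ 1]) (simp add: gt_gf_def gt_patterns_0 gt_size_def)
next
  case (Suc n)
  then obtain K where K: "K \<noteq> 0"
    "\<And>\<mu>. (\<And>i. Suc i < n \<Longrightarrow> \<mu> (Suc i) \<le> \<mu> i) \<Longrightarrow>
      gt_gf q n \<mu> * K = (\<Prod>i<n. q ^ (\<mu> i + (n - 1 - i))) *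
        (\<Prod>j<n. \<Prod>i<j. q ^ (\<mu> j + (n - 1 - j)) - q ^ (\<mu> i + (n - 1 - i)))"
    by blast
  \<comment> \<open>The denominators of the geometric sums, one for each column.\<close>
  define L where "L = (\<Prod>j<n. q ^ Suc j - 1)"
  \<comment> \<open>The sign comes from \<open>det_vandermonde_differences\<close>; the power of
    \<open>q\<close> adds the staircase \<open>n - i\<close> to the exponents \<open>\<mu> i\<close>
    in the leading product.\<close>
  define K' where "K' = (- 1) ^ n * (K * L) * q ^ (\<Sum>i\<le>n. n - i)"
  have "K' \<noteq> 0"
    using assms K(1) by (simp add: K'_def L_def del: power_Suc)
  moreover have "gt_gf q (Suc n) \<mu> * K' = (\<Prod>i<Suc n. q ^ (\<mu> i + (Suc n - 1 - i))) *
        (\<Prod>j<Suc n. \<Prod>i<j. q ^ (\<mu> j + (Suc n - 1 - j)) - q ^ (\<mu> i + (Suc n - 1 - i)))"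
    if dec: "\<And>i. Suc i < Suc n \<Longrightarrow> \<mu> (Suc i) \<le> \<mu> i" for \<mu>
  proof -
    let ?B = "Pi\<^sub>E {..<n} (\<lambda>i. {\<mu> (Suc i)..\<mu> i})"
    let ?x = "\<lambda>i. q ^ (\<mu> i + (n - i))"
    let ?y = "\<lambda>m i. q ^ (m + (n - 1 - i))"
    \<comment> \<open>Absorbing the leading product into the rows raises the exponents from
      \<open>j\<close> to \<open>Suc j\<close>; row \<open>i\<close> depends on \<open>\<nu>\<close>
      through \<open>\<nu> i\<close> alone.\<close>
    have G: "gt_gf q n \<nu> * K = det (mat n n (\<lambda>(i, j). ?y (\<nu> i) i ^ Suc j))" if \<nu>: "\<nu> \<in> ?B" for \<nu>
    proof -
      have "\<nu> (Suc i) \<le> \<nu> i" if "Suc i < n" for i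
        using PiE_mem[OF \<nu>, of i] PiE_mem[OF \<nu>, of "Suc i"] that by simp
      then have "gt_gf q n \<nu> * K = (\<Prod>i<n. ?y (\<nu> i) i) * det (mat n n (\<lambda>(i, j). ?y (\<nu> i) i ^ j))"
        by (simp only: K(2) det_vandermonde)
      then show ?thesis
        by (simp only: det_row_scale[symmetric] power_Suc)
    qed
    have "(\<Sum>\<nu>\<in>?B. gt_gf q n \<nu>) * K * L =
        L * (\<Sum>\<nu>\<in>?B. det (mat n n (\<lambda>(i, j). ?y (\<nu> i) i ^ Suc j)))"
    proof -
      have "(\<Sum>\<nu>\<in>?B. gt_gf q n \<nu>) * K = (\<Sum>\<nu>\<in>?B. det (mat n n (\<lambda>(i, j). ?y (\<nu> i) i ^ Suc j)))"
        unfolding sum_distrib_right by (rule sum.cong[OF refl]) (rule G)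
      then show ?thesis by (simp only: mult.commute)
    qed
    \<comment> \<open>The sum over \<open>\<nu>\<close> moves into the rows, and \<open>L\<close> is
      spread over the columns.\<close>
    also have "\<dots> = det (mat n n (\<lambda>(i, j). (q ^ Suc j - 1) * (\<Sum>m=\<mu> (Suc i)..\<mu> i. ?y m i ^ Suc j)))"
      unfolding L_def det_col_scale det_row_sum_PiE by (rule refl)
    also have "mat n n (\<lambda>(i, j). (q ^ Suc j - 1) * (\<Sum>m=\<mu> (Suc i)..\<mu> i. ?y m i ^ Suc j)) =
        mat n n (\<lambda>(i, j). ?x i ^ Suc j - ?x (Suc i) ^ Suc j)"
    proof (rule eq_matI)
      fix i j assume "i < dim_row (mat n n (\<lambda>(i, j). ?x i ^ Suc j - ?x (Suc i) ^ Suc j))"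
        "j < dim_col (mat n n (\<lambda>(i, j). ?x i ^ Suc j - ?x (Suc i) ^ Suc j))"
      then have ij: "i < n" "j < n" by simp_all
      have "(q ^ Suc j - 1) * (\<Sum>m=\<mu> (Suc i)..\<mu> i. ?y m i ^ Suc j) =
         (q ^ Suc j - 1) * (\<Sum>m=\<mu> (Suc i)..\<mu> i. (q ^ Suc j) ^ (m + (n - 1 - i)))"
        by (simp only: power_mult[symmetric] mult.commute)
      also have "\<dots> = (q ^ Suc j) ^ (Suc (\<mu> i) + (n - 1 - i)) - (q ^ Suc j) ^ (\<mu> (Suc i) + (n - 1 - i))"
        using ij dec by (intro power_sum_diff_Icc) simp
      also have "\<dots> = ?x i ^ Suc j - ?x (Suc i) ^ Suc j"
      proof -
        \<comment> \<open>At the two ends of the interval the staircase of size \<open>n\<close>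
          becomes that of size \<open>Suc n\<close> at \<open>i\<close> and at
          \<open>Suc i\<close>.\<close>
        have "Suc (\<mu> i) + (n - 1 - i) = \<mu> i + (n - i)" "n - 1 - i = n - Suc i"
          using ij by simp_all
        then show ?thesis
          by (simp only: power_mult[symmetric] mult.commute)
      qed
      finally show "mat n n (\<lambda>(i, j). (q ^ Suc j - 1) * (\<Sum>m=\<mu> (Suc i)..\<mu> i. ?y m i ^ Suc j)) $$ (i, j) =
          mat n n (\<lambda>(i, j). ?x i ^ Suc j - ?x (Suc i) ^ Suc j) $$ (i, j)"
        using ij by simp
    qed simp_all
    finally have S: "(- 1) ^ n * ((\<Sum>\<nu>\<in>?B. gt_gf q n \<nu>) * K * L) = (\<Prod>j<Suc n. \<Prod>i<j. ?x j - ?x i)"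
      by (simp only: det_vandermonde[symmetric] det_vandermonde_differences)
    have "gt_gf q (Suc n) \<mu> * K' = (q ^ (\<Sum>i\<le>n. \<mu> i) * q ^ (\<Sum>i\<le>n. n - i)) *
        ((- 1) ^ n * ((\<Sum>\<nu>\<in>?B. gt_gf q n \<nu>) * K * L))"
      by (simp add: gt_gf_Suc K'_def mult_ac)
    also have "q ^ (\<Sum>i\<le>n. \<mu> i) * q ^ (\<Sum>i\<le>n. n - i) = (\<Prod>i<Suc n. ?x i)"
      by (simp only: power_add power_sum prod.distrib lessThan_Suc_atMost)
    finally show ?thesis
      unfolding S by simp
  qed
  ultimately show ?case by blast
qed

section \<open>Plane partitions in a box as patterns\<close>

lemma plane_partitionD:
  assumes "plane_partition_in_box r s t \<pi>"
  shows "i < r \<Longrightarrow> j < s \<Longrightarrow> \<pi> (Suc i) (Suc j) \<le> t"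
    "i < r \<Longrightarrow> j < s \<Longrightarrow> h \<le> i \<Longrightarrow> k \<le> j \<Longrightarrow> \<pi> (Suc i) (Suc j) \<le> \<pi> (Suc h) (Suc k)"
    "\<not> (i \<in> {1..r} \<and> j \<in> {1..s}) \<Longrightarrow> \<pi> i j = 0"
proof -
  note * = assms[unfolded plane_partition_in_box_def]
  show "i < r \<Longrightarrow> j < s \<Longrightarrow> \<pi> (Suc i) (Suc j) \<le> t"
    "\<not> (i \<in> {1..r} \<and> j \<in> {1..s}) \<Longrightarrow> \<pi> i j = 0"
    using * by auto
  assume ij: "i < r" "j < s" "h \<le> i" "k \<le> j"
  have "\<pi> (Suc i) (Suc j) \<le> \<pi> (Suc i) (Suc k)"
    using * ij by auto
  also have "\<dots> \<le> \<pi> (Suc h) (Suc k)"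
    using * ij by auto
  finally show "\<pi> (Suc i) (Suc j) \<le> \<pi> (Suc h) (Suc k)" .
qed

lemma sum_plane_partitions_eq_gt_gf:
  fixes q :: "'a::comm_semiring_1"
  shows "gt_gf q (r + s) (\<lambda>i. if i < r then t else 0) =
    (q ^ (\<Sum>j<r. Suc j)) ^ t * (\<Sum>\<pi> | plane_partition_in_box r s t \<pi>. q ^ pp_size r s \<pi>)"
proof -
  let ?n = "r + s"
  let ?\<mu> = "\<lambda>i. if i < r then t else 0"
  let ?box = "\<lambda>a i j. if i \<in> {1..r} \<and> j \<in> {1..s} then a (i - 1) (r + (j - 1)) else 0"
  let ?tri = "\<lambda>\<pi> i j. if i \<le> j \<and> j < r then t
    else if i < r \<and> r \<le> j \<and> j < ?n then \<pi> (Suc i) (Suc (j - r)) else 0"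
  have size: "gt_size ?n a = (\<Sum>j<r. Suc j) * t + pp_size r s (?box a)"
    if a: "a \<in> gt_patterns ?n ?\<mu>" and tri: "?tri (?box a) = a" for a
  proof -
    have "gt_size ?n a = (\<Sum>j<r. \<Sum>i\<le>j. a i j) + (\<Sum>j<s. \<Sum>i\<le>r + j. a i (r + j))"
    proof -
      have "(\<Sum>j<r + k. f j) = (\<Sum>j<r. f j) + (\<Sum>j<k. f (r + j))" for f :: "nat \<Rightarrow> nat" and k
        by (induction k) simp_all
      then show ?thesis by (simp only: gt_size_def)
    qed
    also have "(\<Sum>j<r. \<Sum>i\<le>j. a i j) = (\<Sum>j<r. \<Sum>i\<le>j. t)"
      by (intro sum.cong refl, subst tri[symmetric]) auto
    also have "\<dots> = (\<Sum>j<r. Suc j) * t"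
      by (simp add: sum_distrib_right)
    also have "(\<Sum>j<s. \<Sum>i\<le>r + j. a i (r + j)) = (\<Sum>j<s. \<Sum>i<r. a i (r + j))"
    proof (rule sum.cong[OF refl])
      fix j assume "j \<in> {..<s}"
      show "(\<Sum>i\<le>r + j. a i (r + j)) = (\<Sum>i<r. a i (r + j))"
      proof (rule sum.mono_neutral_right)
        show "\<forall>i\<in>{..r + j} - {..<r}. a i (r + j) = 0"
          by (subst tri[symmetric]) auto
      qed auto
    qed
    also have "\<dots> = pp_size r s (?box a)"
      unfolding pp_size_def by (subst sum.swap) (simp add: sum.atLeast1_atMost_eq)
    finally show ?thesis .
  qed
  have tri_box: "?tri (?box a) = a" if a: "a \<in> gt_patterns ?n ?\<mu>" for a
  proof (intro ext)
    fix i j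
    \<comment> \<open>Each entry is squeezed between the diagonal entries of its column and of its
      row.\<close>
    have *: "a j j \<le> a i j" "a i j \<le> a i i" if "i \<le> j" "j < ?n"
      using gt_patterns_col_antimono[OF a, of i j j] gt_patterns_row_antimono[OF a, of i i j] that
      by simp_all
    show "?tri (?box a) i j = a i j"
      using * gt_patternsD(1)[OF a] gt_patternsD(4)[OF a, of j i]
      by (cases "i \<le> j \<and> j < ?n"; cases "i < r"; cases "j < r") auto
  qed
  have "gt_gf q ?n ?\<mu> = (\<Sum>\<pi> | plane_partition_in_box r s t \<pi>.
      (q ^ (\<Sum>j<r. Suc j)) ^ t * q ^ pp_size r s \<pi>)"
    unfolding gt_gf_def
  proof (rule sum.reindex_bij_witness[where i = ?tri and j = ?box], goal_cases)
    case (1 a)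
    then show ?case by (rule tri_box)
  next
    case (2 a)
    have *: "a i j \<le> t" if "i < r" "j < ?n" "i \<le> j" for i j
      using gt_patterns_row_antimono[OF 2, of i i j] gt_patternsD(1)[OF 2, of i] that by simp
    have row: "a i (r + k) \<le> a i (r + j)" if "i < r" "j \<le> k" "k < s" for i j k
      using gt_patterns_row_antimono[OF 2, of i "r + j" "r + k"] that by simp
    have col: "a i (r + k) \<le> a h (r + k)" if "h \<le> i" "i < r" "k < s" for h i k
      using gt_patterns_col_antimono[OF 2, of h i "r + k"] that by simp
    show ?case
      unfolding mem_Collect_eq plane_partition_in_box_def
    proof (intro conjI ballI allI impI, goal_cases)
      case (1 i j)
      then show ?case using *[of "i - 1" "r + (j - 1)"] by auto
    next
      case (2 i j k)
      then show ?case using row[of "i - 1" "j - 1" "k - 1"] by auto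
    next
      case (3 h i j)
      then show ?case using col[of "h - 1" "i - 1" "j - 1"] by auto
    qed auto
  next
    case (3 \<pi>)
    show ?case
      using plane_partitionD(3)[OF 3[simplified]] by (auto simp: fun_eq_iff)
  next
    case (4 \<pi>)
    note \<pi> = plane_partitionD[OF 4[simplified]]
    show ?case
      unfolding gt_patterns_def
    proof (intro CollectI conjI allI impI)
      \<comment> \<open>At \<open>j = r\<close> the left neighbour is a frozen \<open>t\<close>; at
        \<open>Suc i = r \<le> j\<close> the entry below is 0.\<close>
      fix i j assume "i < j \<and> j < ?n"
      then show "?tri \<pi> (Suc i) j \<le> ?tri \<pi> i j" "?tri \<pi> i j \<le> ?tri \<pi> i (j - 1)"
        using \<pi>(1)[of i "j - r"] \<pi>(2)[of "Suc i" "j - r" i "j - r"]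
          \<pi>(2)[of i "j - r" i "j - 1 - r"] by auto
    qed auto
  next
    case (5 a)
    show ?case
      by (subst size[OF 5 tri_box[OF 5]]) (simp only: power_add power_mult)
  qed
  then show ?thesis
    by (simp only: sum_distrib_left)
qed

section \<open>MacMahon's product formula\<close>

text \<open>The first \<open>r\<close> nodes are \<open>q ^ t\<close> times their values at
  \<open>t = 0\<close>; the others do not involve \<open>t\<close>. The leading product and the
  differences within the first block thus give \<open>q ^ t\<close> to the power
  \<open>r + (0 + ... + (r - 1)) = 1 + ... + r\<close>, and only differences across the blocks give
  the factors \<open>1 - q ^ (t + a + b + 1)\<close>.\<close>

lemma vandermonde_two_blocks:
  fixes q :: "'a::comm_ring_1"
  shows "\<exists>C. \<forall>t. (let x = \<lambda>i. q ^ ((if i < r then t else 0) + (r + s - 1 - i)) in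
    (\<Prod>i<r + s. x i) * (\<Prod>j<r + s. \<Prod>i<j. x j - x i)) =
    C * (q ^ (\<Sum>j<r. Suc j)) ^ t * (\<Prod>b<s. \<Prod>a<r. 1 - q ^ (t + a + b + 1))"
proof -
  let ?z = "\<lambda>i. q ^ (r + s - 1 - i)"
  let ?C = "(\<Prod>i<r + s. ?z i) * (\<Prod>j<r. \<Prod>i<j. ?z j - ?z i) *
    (\<Prod>b<s. (\<Prod>a<r. ?z (r + b)) * (\<Prod>i<b. ?z (r + b) - ?z (r + i)))"
  have split: "(\<Prod>j<r + k. f j) = (\<Prod>j<r. f j) * (\<Prod>b<k. f (r + b))" for f :: "nat \<Rightarrow> 'a" and k
    by (induction k) (simp_all add: mult.assoc)
  have "(\<Prod>i<r + s. x i) * (\<Prod>j<r + s. \<Prod>i<j. x j - x i) =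
      ?C * (q ^ (\<Sum>j<r. Suc j)) ^ t * (\<Prod>b<s. \<Prod>a<r. 1 - q ^ (t + a + b + 1))"
    if x: "x = (\<lambda>i. q ^ ((if i < r then t else 0) + (r + s - 1 - i)))" for x t
  proof -
    have lo: "x i = q ^ t * ?z i" if "i < r" for i
      using that by (simp add: x power_add)
    have hi: "x (r + b) = ?z (r + b)" for b
      by (simp add: x)
    have 1: "(\<Prod>i<r + s. x i) = (q ^ t) ^ r * (\<Prod>i<r + s. ?z i)"
      by (simp add: split hi lo prod.distrib mult.assoc)
    have "(\<Prod>j<r. \<Prod>i<j. x j - x i) = (\<Prod>j<r. (q ^ t) ^ j * (\<Prod>i<j. ?z j - ?z i))"
    proof (intro prod.cong refl)
      fix j assume "j \<in> {..<r}"
      then have "(\<Prod>i<j. x j - x i) = (\<Prod>i<j. q ^ t * (?z j - ?z i))"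
        by (intro prod.cong refl) (simp add: lo right_diff_distrib)
      then show "(\<Prod>i<j. x j - x i) = (q ^ t) ^ j * (\<Prod>i<j. ?z j - ?z i)"
        by (simp add: prod.distrib)
    qed
    also have "\<dots> = (q ^ t) ^ (\<Sum>j<r. j) * (\<Prod>j<r. \<Prod>i<j. ?z j - ?z i)"
      by (simp only: prod.distrib power_sum)
    finally have 2: "(\<Prod>j<r. \<Prod>i<j. x j - x i) = \<dots>" .
    have 3: "(\<Prod>i<r + b. x (r + b) - x i) = (\<Prod>a<r. ?z (r + b)) *
        (\<Prod>i<b. ?z (r + b) - ?z (r + i)) * (\<Prod>a<r. 1 - q ^ (t + a + b + 1))" if b: "b < s" for b
    proof -
      have "(\<Prod>i<r. x (r + b) - x i) = (\<Prod>i<r. ?z (r + b) * (1 - q ^ (t + (r - Suc i) + b + 1)))"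
      proof (intro prod.cong refl)
        fix i assume i: "i \<in> {..<r}"
        \<comment> \<open>By \<open>i < r\<close> and \<open>b < s\<close> no subtraction is
          truncated, so \<open>?z (r + b)\<close> can be factored out of \<open>x i\<close>.\<close>
        have "t + (r + s - 1 - i) = (r + s - 1 - (r + b)) + (t + (r - Suc i) + b + 1)"
          using i b by auto
        then have "x i = ?z (r + b) * q ^ (t + (r - Suc i) + b + 1)"
          using i by (simp only: x power_add[symmetric] lessThan_iff if_True)
        then show "x (r + b) - x i = ?z (r + b) * (1 - q ^ (t + (r - Suc i) + b + 1))"
          by (simp only: hi right_diff_distrib mult_1_right)
      qed
      also have "\<dots> = (\<Prod>a<r. ?z (r + b)) * (\<Prod>i<r. 1 - q ^ (t + (r - Suc i) + b + 1))"
        by (rule prod.distrib)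
      also have "(\<Prod>i<r. 1 - q ^ (t + (r - Suc i) + b + 1)) = (\<Prod>a<r. 1 - q ^ (t + a + b + 1))"
        by (rule prod.nat_diff_reindex)
      finally show ?thesis
        by (simp only: split hi mult_ac)
    qed
    have e: "(q ^ (\<Sum>j<r. Suc j)) ^ t = (q ^ t) ^ r * (q ^ t) ^ (\<Sum>j<r. j)"
      by (simp add: sum_Suc power_add power_mult_distrib flip: power_mult)
        (simp add: mult.commute)
    have "(\<Prod>b<s. \<Prod>i<r + b. x (r + b) - x i) =
        (\<Prod>b<s. (\<Prod>a<r. ?z (r + b)) * (\<Prod>i<b. ?z (r + b) - ?z (r + i))) *
        (\<Prod>b<s. \<Prod>a<r. 1 - q ^ (t + a + b + 1))"
      unfolding prod.distrib[symmetric] by (rule prod.cong[OF refl]) (use 3 in simp)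
    then show ?thesis
      unfolding e 1 split[of "\<lambda>j. \<Prod>i<j. x j - x i"] 2 by (simp only: mult_ac)
  qed
  then show ?thesis
    by (intro exI[of _ ?C] allI) (simp only: Let_def)
qed

theorem plane_partition_product_formula:
  "PP r s t * (\<Prod>b<s. \<Prod>a<r. 1 - monom 1 (a + b + 1)) =
    (\<Prod>b<s. \<Prod>a<r. 1 - monom 1 (t + a + b + 1))"
proof -
  define q :: "int poly" where "q = monom 1 1"
  have monom: "monom 1 n = q ^ n" for n
    by (simp add: q_def monom_power)
  have q: "q \<noteq> 0" "\<And>k. k > 0 \<Longrightarrow> q ^ k \<noteq> 1"
    by (auto simp: q_def monom_power monom_eq_1_iff)
  let ?\<mu> = "\<lambda>t i. if i < r then t else 0"
  let ?Q = "\<lambda>t. (q ^ (\<Sum>j<r. Suc j)) ^ t"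
  let ?M = "\<lambda>t. \<Prod>b<s. \<Prod>a<r. 1 - q ^ (t + a + b + 1)"
  obtain K where K: "K \<noteq> 0" "\<And>t. gt_gf q (r + s) (?\<mu> t) * K =
      (\<Prod>i<r + s. q ^ (?\<mu> t i + (r + s - 1 - i))) *
      (\<Prod>j<r + s. \<Prod>i<j. q ^ (?\<mu> t j + (r + s - 1 - j)) - q ^ (?\<mu> t i + (r + s - 1 - i)))"
    using gt_gf_vandermonde[OF q, of "r + s"] by auto
  obtain C where C: "\<And>t. (\<Prod>i<r + s. q ^ (?\<mu> t i + (r + s - 1 - i))) *
      (\<Prod>j<r + s. \<Prod>i<j. q ^ (?\<mu> t j + (r + s - 1 - j)) - q ^ (?\<mu> t i + (r + s - 1 - i))) =
      C * ?Q t * ?M t"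
    using vandermonde_two_blocks[where q = q and r = r and s = s] unfolding Let_def by blast
  have "gt_gf q (r + s) (?\<mu> t) = ?Q t * PP r s t" for t
    unfolding PP_def monom by (rule sum_plane_partitions_eq_gt_gf)
  then have "?Q t * (PP r s t * K) = ?Q t * (C * ?M t)" for t
    using K(2)[of t] C[of t] by (simp add: mult_ac)
  then have P: "PP r s t * K = C * ?M t" for t
    using q(1) by simp
  \<comment> \<open>At \<open>t = 0\<close> only the zero partition remains, which expresses
    \<open>K\<close> through \<open>C\<close>; as \<open>K\<close> is nonzero, so is
    \<open>C\<close>.\<close>
  from P[of 0] have K_eq: "K = C * ?M 0"
    by (simp add: PP_degenerate)
  then have "C * (PP r s t * ?M 0) = C * ?M t"
    using P[of t] by (simp only: mult_ac)
  moreover have "C \<noteq> 0"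
    using K(1) K_eq by auto
  ultimately show ?thesis
    by (simp add: monom)
qed

section \<open>The recurrence from the product formula\<close>

theorem theorem6p2:
  fixes r s t :: nat
  assumes "t \<ge> 1"
  shows "PP (r + 1) (s + 1) t * PP r s t =
           monom 1 t * PP r (s + 1) t * PP (r + 1) s t
           + PP (r + 1) (s + 1) (t - 1) * PP r s (t + 1)"
proof -
  define f :: "nat \<Rightarrow> int poly" where "f k = 1 - monom 1 k" for k
  define M where "M r s t = (\<Prod>b<s. \<Prod>a<r. f (t + a + b + 1))" for r s t
  have P: "PP r s t * M r s 0 = M r s t" for r s t
    using plane_partition_product_formula[of r s t] by (simp add: M_def f_def)
  have M_nz: "M r s t \<noteq> 0" for r s t
    by (auto simp: M_def f_def monom_eq_1_iff)
  have M_Suc_row: "M (Suc r) s t = M r s t * (\<Prod>b<s. f (t + r + b + 1))" for r s t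
    by (simp add: M_def prod.distrib)
  have M_Suc_col: "M r (Suc s) t = M r s t * (\<Prod>a<r. f (t + a + s + 1))" for r s t
    by (simp add: M_def)
  \<comment> \<open>Adding a last row and a last column separately misses only the corner factor at
    \<open>a = r\<close>, \<open>b = s\<close>.\<close>
  have A: "M (Suc r) (Suc s) t * M r s t = M r (Suc s) t * M (Suc r) s t * f (t + r + s + 1)" for t
    by (simp add: M_Suc_row M_Suc_col mult_ac)
  \<comment> \<open>Peeling off the first row or column instead of the last leaves a product at
    \<open>Suc t\<close>.\<close>
  have M_shift_col: "M r (Suc s) t = (\<Prod>a<r. f (t + a + 1)) * M r s (Suc t)" for r s t
    unfolding M_def by (subst prod.lessThan_Suc_shift) simp
  have M_shift_row: "M (Suc r) s t = (\<Prod>b<s. f (t + b + 1)) * M r s (Suc t)" for r s t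
    unfolding M_def by (simp only: prod.lessThan_Suc_shift prod.distrib) simp
  obtain u where u: "t = Suc u"
    using assms by (cases t) auto
  \<comment> \<open>Here the corner is \<open>a = b = 0\<close>, with factor
    \<open>f (u + 1) = f t\<close>.\<close>
  have B: "M (Suc r) (Suc s) u * M r s (Suc t) = M r (Suc s) t * M (Suc r) s t * f t"
    unfolding M_shift_row[of r "Suc s"] M_shift_col[of r s] M_shift_row[of r s] u
    by (subst prod.lessThan_Suc_shift) (simp add: mult_ac)
  have f: "f (t + r + s + 1) = monom 1 t * f (r + s + 1) + f t"
    by (simp add: f_def algebra_simps mult_monom)
  \<comment> \<open>A common denominator: by \<open>A\<close> at 0 it equals
    \<open>M r (Suc s) 0 * M (Suc r) s 0 * f (r + s + 1)\<close>, so it also clears the mixed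
    product.\<close>
  let ?D = "M (Suc r) (Suc s) 0 * M r s 0"
  have "PP (Suc r) (Suc s) t * PP r s t * ?D = M (Suc r) (Suc s) t * M r s t"
    unfolding P[symmetric, of _ _ t] by (simp only: mult_ac)
  also have "\<dots> = monom 1 t * (M r (Suc s) t * M (Suc r) s t * f (r + s + 1)) +
      M (Suc r) (Suc s) u * M r s (Suc t)"
    unfolding A B f by (simp add: algebra_simps)
  also have "M r (Suc s) t * M (Suc r) s t * f (r + s + 1) = PP r (Suc s) t * PP (Suc r) s t * ?D"
    unfolding P[symmetric, of _ _ t] A[of 0] by (simp add: mult_ac)
  also have "M (Suc r) (Suc s) u * M r s (Suc t) = PP (Suc r) (Suc s) u * PP r s (Suc t) * ?D"
    unfolding P[symmetric, of _ _ u] P[symmetric, of _ _ "Suc t"] by (simp only: mult_ac)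
  finally have "(PP (Suc r) (Suc s) t * PP r s t) * ?D =
      (monom 1 t * PP r (Suc s) t * PP (Suc r) s t + PP (Suc r) (Suc s) u * PP r s (Suc t)) * ?D"
    by (simp add: algebra_simps)
  then show ?thesis
    using M_nz by (simp add: u)
qed

end
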